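(* Let $H$ be a bounded $\vee$-hoop algebra with the double negation property and let $s:H\to H$ be a square root on $H$. Then the following conditions are equivalent: (i) $H$ is good, i.e. $s(0)=0$; (ii) $H$ is a Boolean algebra.
   Context: A hoop algebra is an algebra $(H;\odot,\rightarrow,1)$ of type $(2,2,0)$ such that $(H;\odot,1)$ is a commutative monoid and, for all $x,y,z\in H$: $x\rightarrow x=1$; $x\odot(x\rightarrow y)=y\odot(y\rightarrow x)$; $(x\odot y)\rightarrow z=x\rightarrow(y\rightarrow z)$. It is partially ordered by $x\le y$ iff $x\rightarrow y=1$, and is a meet-semilattice with $x\wedge y=x\odot(x\rightarrow y)$. $H$ is bounded if it has a least element $0$; then $x':=x\rightarrow 0$. The double negation property (DNP) means $x''=x$ for all $x\in H$. Put $x\vee y:=((x\rightarrow y)\rightarrow y)\wedge((y\rightarrow x)\rightarrow x)$; $H$ is a $\vee$-hoop if $\vee$ is the join operation for $\le$. A square root on $H$ is a map $s:H\to H$ such that (1) $s(x)\odot s(x)=x$ for every $x\in H$; (2) for all $x,y\in H$, if $y\odot y\le x$ then $y\le s(x)$. A bounded hoop with square root $s$ is called good if $s(0)=0$. "$H$ is a Boolean algebra" means that $(H;\vee,\wedge,{}',0,1)$ is a Boolean algebra. *)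

theory Defs
  imports Main
begin

(* The carrier of the algebra is the whole type 'a. *)
locale hoop = comm_monoid mult one
  for mult :: "'a \<Rightarrow> 'a \<Rightarrow> 'a" (infixl "\<odot>" 70)
    and imp :: "'a \<Rightarrow> 'a \<Rightarrow> 'a" (infixr "\<rightarrow>" 60)
    and one :: 'a ("\<one>") +
  assumes imp_refl: "x \<rightarrow> x = \<one>"
    and divisibility: "x \<odot> (x \<rightarrow> y) = y \<odot> (y \<rightarrow> x)"
    and currying: "(x \<odot> y) \<rightarrow> z = x \<rightarrow> (y \<rightarrow> z)"
begin

definition le :: "'a \<Rightarrow> 'a \<Rightarrow> bool" (infix "\<preceq>" 50)
  where "x \<preceq> y \<longleftrightarrow> x \<rightarrow> y = \<one>"

definition meet :: "'a \<Rightarrow> 'a \<Rightarrow> 'a" (infixl "\<sqinter>" 65)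
  where "x \<sqinter> y = x \<odot> (x \<rightarrow> y)"

(* Defined in every hoop; it need not be the join for the order (see vee_hoop). *)
definition vee :: "'a \<Rightarrow> 'a \<Rightarrow> 'a" (infixl "\<squnion>" 65)
  where "x \<squnion> y = ((x \<rightarrow> y) \<rightarrow> y) \<sqinter> ((y \<rightarrow> x) \<rightarrow> x)"

definition square_root :: "('a \<Rightarrow> 'a) \<Rightarrow> bool"
  where "square_root s \<longleftrightarrow>
    (\<forall>x. s x \<odot> s x = x) \<and> (\<forall>x y. y \<odot> y \<preceq> x \<longrightarrow> y \<preceq> s x)"

end

locale vee_hoop = hoop +
  assumes vee_upper1: "x \<preceq> x \<squnion> y"
    and vee_upper2: "y \<preceq> x \<squnion> y"
    and vee_least: "x \<preceq> z \<Longrightarrow> y \<preceq> z \<Longrightarrow> x \<squnion> y \<preceq> z"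

locale bounded_hoop = hoop +
  fixes zero :: 'a ("\<zero>")
  assumes zero_least: "\<zero> \<preceq> x"
begin

definition compl :: "'a \<Rightarrow> 'a"
  where "compl x = x \<rightarrow> \<zero>"

definition double_negation_property :: bool
  where "double_negation_property \<longleftrightarrow> (\<forall>x. compl (compl x) = x)"

definition good :: "('a \<Rightarrow> 'a) \<Rightarrow> bool"
  where "good s \<longleftrightarrow> s \<zero> = \<zero>"

(* The library locale abstract_boolean_algebra admits the one-element algebra. *)
definition is_boolean_algebra :: bool
  where "is_boolean_algebra \<longleftrightarrow> abstract_boolean_algebra (\<sqinter>) (\<squnion>) compl \<zero> \<one>"

end

locale bounded_vee_hoop = bounded_hoop + vee_hoop

end

theory Submission
  imports Defs
begin

text \<open>
  The lattice is distributive because \<open>x \<sqinter> (y \<squnion> z) = (y \<squnion> z) \<odot> ((y \<squnion> z) \<rightarrow> x)\<close> and multiplication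
  distributes over joins; so it is Boolean as soon as \<open>compl x\<close> is a complement of \<open>x\<close>.
  If \<open>s \<zero> = \<zero>\<close>, then \<open>\<zero>\<close> is the only element whose square is \<open>\<zero>\<close>. The square of
  \<open>x \<sqinter> compl x\<close> lies below \<open>x \<odot> compl x = \<zero>\<close>, hence \<open>x \<sqinter> compl x = \<zero>\<close>; double negation
  turns this into \<open>x \<squnion> compl x = \<one>\<close>. Conversely, \<open>t = s \<zero>\<close> satisfies
  \<open>t \<odot> t = \<zero>\<close>, that is, \<open>t \<preceq> compl t\<close>, which in a Boolean algebra forces \<open>t = \<zero>\<close>.
\<close>

context hoop
begin

lemma le_refl: "x \<preceq> x"
  by (simp add: le_def imp_refl)

lemma le_antisym: "x \<preceq> y \<Longrightarrow> y \<preceq> x \<Longrightarrow> x = y"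
  by (metis comm_neutral divisibility le_def)

lemma residuation: "x \<odot> y \<preceq> z \<longleftrightarrow> x \<preceq> y \<rightarrow> z"
  by (simp add: le_def currying)

text \<open>Not an axiom, and needed before \<open>\<preceq>\<close> is known to be transitive, so
  the argument is purely equational: it establishes that \<open>x \<rightarrow> \<one>\<close> acts
  as an identity on \<open>x\<close>.\<close>

lemma imp_one: "x \<rightarrow> \<one> = \<one>"
proof -
  let ?a = "\<one> \<rightarrow> x" and ?b = "x \<rightarrow> \<one>"
  have a: "?a = x \<odot> ?b"
    using divisibility[of \<one> x] by (simp add: left_neutral)
  have "?b \<odot> (?b \<rightarrow> \<one>) = \<one> \<odot> (\<one> \<rightarrow> ?b)"
    by (rule divisibility)
  also have "\<one> \<odot> (\<one> \<rightarrow> ?b) = ?b"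
    by (simp add: left_neutral flip: currying)
  finally have b: "?b \<odot> (?b \<rightarrow> \<one>) = ?b" .
  have "?a \<rightarrow> x = (?b \<odot> x) \<rightarrow> x"
    by (simp add: a commute)
  also have "\<dots> = ?b \<rightarrow> \<one>"
    by (simp add: currying imp_refl)
  finally have ax: "?a \<rightarrow> x = ?b \<rightarrow> \<one>" .
  have "x \<rightarrow> ?a = \<one>"
    by (simp add: comm_neutral imp_refl flip: currying)
  \<comment> \<open>Divisibility for \<open>x\<close> and \<open>?a\<close>, whose left side
    collapses to \<open>x\<close>; by \<open>ax\<close> and \<open>b\<close> the right side then
    becomes \<open>x \<odot> ?b\<close>.\<close>
  then have "x = ?a \<odot> (?a \<rightarrow> x)"
    using divisibility[of x ?a] by (simp add: comm_neutral)
  also have "\<dots> = x \<odot> ?b"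
    unfolding ax by (simp add: a assoc b)
  finally have "x = ?b \<odot> x"
    by (simp add: commute)
  \<comment> \<open>Replace \<open>x\<close> by \<open>?b \<odot> x\<close> in
    \<open>x \<rightarrow> \<one>\<close> and curry.\<close>
  then have "?b = ?b \<rightarrow> ?b"
    by (metis currying)
  then show ?thesis
    by (simp add: imp_refl)
qed

lemma le_one: "x \<preceq> \<one>"
  by (simp add: le_def imp_one)

text \<open>Divisibility makes the order the natural one: smaller elements are multiples of larger
  ones. Transitivity follows by composing factors.\<close>

lemma le_eq_mult: "x \<preceq> y \<Longrightarrow> x = y \<odot> (y \<rightarrow> x)"
  by (metis comm_neutral divisibility le_def)

lemma mult_le_left: "x \<odot> y \<preceq> x"
  by (metis commute currying imp_one imp_refl le_def)

lemma le_trans: "x \<preceq> y \<Longrightarrow> y \<preceq> z \<Longrightarrow> x \<preceq> z"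
  by (metis assoc le_eq_mult mult_le_left)

lemma mult_mono_left: "x \<preceq> y \<Longrightarrow> x \<odot> z \<preceq> y \<odot> z"
  by (metis le_refl le_trans residuation)

lemma mult_mono: "x \<preceq> y \<Longrightarrow> u \<preceq> v \<Longrightarrow> x \<odot> u \<preceq> y \<odot> v"
  by (metis commute le_trans mult_mono_left)

lemma meet_le_left: "x \<sqinter> y \<preceq> x"
  by (simp add: meet_def mult_le_left)

lemma meet_commute: "x \<sqinter> y = y \<sqinter> x"
  by (simp add: meet_def divisibility)

lemma meet_le_right: "x \<sqinter> y \<preceq> y"
  by (metis meet_commute meet_le_left)

lemma meet_greatest:
  assumes "z \<preceq> x" "z \<preceq> y"
  shows "z \<preceq> x \<sqinter> y"
proof -
  \<comment> \<open>Writing \<open>z\<close> as a multiple of \<open>x\<close> lets residuation turn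
    \<open>z \<preceq> y\<close> into a bound on the factor.\<close>
  have z: "z = (x \<rightarrow> z) \<odot> x"
    using le_eq_mult[OF assms(1)] by (simp add: commute)
  then have "x \<rightarrow> z \<preceq> x \<rightarrow> y"
    using assms(2) by (metis residuation)
  then show ?thesis
    using z by (metis commute meet_def mult_mono_left)
qed

lemma meet_absorb: "x \<preceq> y \<Longrightarrow> x \<sqinter> y = x"
  by (simp add: meet_def le_def)

lemma meet_assoc: "x \<sqinter> y \<sqinter> z = x \<sqinter> (y \<sqinter> z)"
  by (rule le_antisym; intro meet_greatest)
    (blast intro: le_trans meet_le_left meet_le_right)+

end

context vee_hoop
begin

lemma vee_commute: "x \<squnion> y = y \<squnion> x"
  by (simp add: vee_def meet_commute)

lemma vee_absorb: "x \<preceq> y \<Longrightarrow> y \<squnion> x = y"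
  by (blast intro: le_antisym vee_least vee_upper1 le_refl)

lemma vee_assoc: "x \<squnion> y \<squnion> z = x \<squnion> (y \<squnion> z)"
  by (rule le_antisym; intro vee_least)
    (blast intro: le_trans vee_upper1 vee_upper2)+

lemma meet_vee_distrib: "x \<sqinter> (y \<squnion> z) = (x \<sqinter> y) \<squnion> (x \<sqinter> z)"
proof (rule le_antisym)
  \<comment> \<open>To be used for \<open>u = y\<close> and \<open>u = z\<close>. Enlarging
    \<open>u\<close> to the join turns the product into a meet with \<open>x\<close>.\<close>
  have bound: "u \<odot> ((y \<squnion> z) \<rightarrow> x) \<preceq> x \<sqinter> u" if "u \<preceq> y \<squnion> z" for u
  proof (rule meet_greatest)
    show "u \<odot> ((y \<squnion> z) \<rightarrow> x) \<preceq> x"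
      using mult_mono_left[OF that] le_trans by (metis meet_def meet_le_right)
  qed (rule mult_le_left)
  \<comment> \<open>With the factor moved to the right by residuation, the two joinands can be
    checked separately.\<close>
  have "y \<squnion> z \<preceq> ((y \<squnion> z) \<rightarrow> x) \<rightarrow> ((x \<sqinter> y) \<squnion> (x \<sqinter> z))"
    by (intro vee_least)
      (metis residuation bound le_trans vee_upper1 vee_upper2)+
  then show "x \<sqinter> (y \<squnion> z) \<preceq> (x \<sqinter> y) \<squnion> (x \<sqinter> z)"
    by (metis meet_commute meet_def residuation)
  show "(x \<sqinter> y) \<squnion> (x \<sqinter> z) \<preceq> x \<sqinter> (y \<squnion> z)"
    by (intro vee_least meet_greatest meet_le_left)
      (blast intro: le_trans meet_le_right vee_upper1 vee_upper2)+
qed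

lemma vee_meet_distrib: "x \<squnion> (y \<sqinter> z) = (x \<squnion> y) \<sqinter> (x \<squnion> z)"
proof -
  have "(x \<squnion> y) \<sqinter> (x \<squnion> z) = ((x \<squnion> y) \<sqinter> x) \<squnion> ((x \<squnion> y) \<sqinter> z)"
    by (rule meet_vee_distrib)
  also have "(x \<squnion> y) \<sqinter> x = x"
    by (metis meet_absorb meet_commute vee_upper1)
  also have "(x \<squnion> y) \<sqinter> z = (x \<sqinter> z) \<squnion> (y \<sqinter> z)"
    by (metis meet_commute meet_vee_distrib)
  also have "x \<squnion> ((x \<sqinter> z) \<squnion> (y \<sqinter> z)) = x \<squnion> (y \<sqinter> z)"
    by (metis vee_absorb meet_le_left vee_assoc)
  finally show ?thesis ..
qed

end

context bounded_hoop
begin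

lemma le_zero: "x \<preceq> \<zero> \<Longrightarrow> x = \<zero>"
  by (simp add: le_antisym zero_least)

lemma le_compl_iff: "x \<preceq> compl y \<longleftrightarrow> x \<odot> y = \<zero>"
  by (metis compl_def le_refl le_zero residuation)

text \<open>Since \<open>x \<odot> y = \<zero>\<close> is symmetric in \<open>x\<close> and
  \<open>y\<close>, \<open>compl\<close> forms a Galois connection with itself.\<close>

lemma compl_antimono: "x \<preceq> y \<Longrightarrow> compl y \<preceq> compl x"
  by (metis commute le_compl_iff le_refl le_trans)

lemma compl_zero: "compl \<zero> = \<one>"
  by (simp add: compl_def imp_refl)

lemma good_meet_compl:
  assumes "square_root s" and "good s"
  shows "x \<sqinter> compl x = \<zero>"
proof -
  have "(x \<sqinter> compl x) \<odot> (x \<sqinter> compl x) \<preceq> x \<odot> compl x"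
    by (intro mult_mono meet_le_left meet_le_right)
  also have "x \<odot> compl x = \<zero>"
    by (metis commute le_compl_iff le_refl)
  finally have "x \<sqinter> compl x \<preceq> s \<zero>"
    using assms(1) by (simp add: square_root_def)
  then show ?thesis
    using assms(2) by (simp add: good_def le_zero)
qed

lemma meet_compl_good:
  assumes "square_root s" and "\<And>x. x \<sqinter> compl x = \<zero>"
  shows "good s"
  using assms unfolding good_def square_root_def by (metis le_compl_iff meet_absorb)

end

context bounded_vee_hoop
begin

lemma vee_compl:
  assumes "double_negation_property" and "x \<sqinter> compl x = \<zero>"
  shows "x \<squnion> compl x = \<one>"
proof -
  \<comment> \<open>Half of De Morgan's law, with \<open>compl (compl x)\<close> replaced by
    \<open>x\<close>.\<close>
  have "compl (x \<squnion> compl x) \<preceq> x \<sqinter> compl x"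
    using assms(1) compl_antimono[OF vee_upper1] compl_antimono[OF vee_upper2]
    by (metis double_negation_property_def meet_greatest)
  then have "compl (x \<squnion> compl x) = \<zero>"
    using assms(2) by (simp add: le_zero)
  then show ?thesis
    using assms(1) by (metis compl_zero double_negation_property_def)
qed

text \<open>Reduces condition (ii) to the single equation that goodness is also compared with; the
  distributive lattice laws hold already.\<close>

lemma is_boolean_algebra_iff:
  assumes "double_negation_property"
  shows "is_boolean_algebra \<longleftrightarrow> (\<forall>x. x \<sqinter> compl x = \<zero>)"
proof
  assume "is_boolean_algebra"
  then show "\<forall>x. x \<sqinter> compl x = \<zero>"
    by (simp add: is_boolean_algebra_def abstract_boolean_algebra.conj_cancel_right)
next
  assume zero: "\<forall>x. x \<sqinter> compl x = \<zero>"
  show "is_boolean_algebra"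
    unfolding is_boolean_algebra_def
  proof unfold_locales
    fix x y z
    show "x \<sqinter> y \<sqinter> z = x \<sqinter> (y \<sqinter> z)" by (rule meet_assoc)
    show "x \<sqinter> y = y \<sqinter> x" by (rule meet_commute)
    show "x \<squnion> y \<squnion> z = x \<squnion> (y \<squnion> z)" by (rule vee_assoc)
    show "x \<squnion> y = y \<squnion> x" by (rule vee_commute)
    show "x \<sqinter> (y \<squnion> z) = (x \<sqinter> y) \<squnion> (x \<sqinter> z)" by (rule meet_vee_distrib)
    show "x \<squnion> (y \<sqinter> z) = (x \<squnion> y) \<sqinter> (x \<squnion> z)" by (rule vee_meet_distrib)
    show "x \<sqinter> \<one> = x" by (rule meet_absorb[OF le_one])
    show "x \<squnion> \<zero> = x" by (rule vee_absorb[OF zero_least])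
    show "x \<sqinter> compl x = \<zero>" by (simp add: zero)
    show "x \<squnion> compl x = \<one>" by (simp add: vee_compl assms zero)
  qed
qed

end

theorem theorem4p19:
  fixes mult imp :: "'a \<Rightarrow> 'a \<Rightarrow> 'a" and one zero :: 'a and s :: "'a \<Rightarrow> 'a"
  assumes "bounded_vee_hoop mult imp one zero"
    and "bounded_hoop.double_negation_property imp zero"
    and "hoop.square_root mult imp one s"
  shows "bounded_hoop.good zero s \<longleftrightarrow>
    bounded_hoop.is_boolean_algebra mult imp one zero"
proof -
  interpret bounded_vee_hoop mult imp one zero
    by (fact assms(1))
  show ?thesis
    using is_boolean_algebra_iff[OF assms(2)] good_meet_compl[OF assms(3)]
      meet_compl_good[OF assms(3)] by blast
qed

end
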